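(* Let $x_1,\dots,x_n\in\mathbb{R}^m$, let $X\in\mathbb{R}^{n\times m}$ be the matrix with rows $x_i^{\top}$, let $y_1,\dots,y_n\in\mathbb{R}^c$ be one-hot vectors, $y_i=(y_i^{(1)},\dots,y_i^{(c)})^\top$, and let $\lambda>0$. Consider the convex differentiable minimization problem $$\min_{W\in\mathbb{R}^{c\times m}} G(W):=L(W)+\lambda\|X,XW^{\top}\|_*,$$ $$L(W)=-\frac1n\sum_{i=1}^n\Big(\sum_{j=1}^c y_i^{(j)}w_j^{\top}x_i-\log\sum_{j=1}^c\exp(w_j^{\top}x_i)\Big),$$ where $w_j^\top$ is the $j$-th row of $W$. Suppose all singular values of the output matrix $XW^{\top}$ are nonzero (for all $W$). Let $\{W^k\}_{k=0}^\infty$ be generated by the gradient descent procedure $$W^{k+1}=W^k-\alpha_k\nabla G(W^k),$$ where the stepsize $\alpha_k$ is obtained by the Moré–Thuente line search algorithm with guaranteed sufficient decrease. Then each accumulation point of the sequence $\{W^k\}_{k=0}^\infty$ is a global minimizer of the problem.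
   Context: $[X,XW^\top]\in\mathbb{R}^{n\times(m+c)}$ is the side-by-side concatenation and $\|X,XW^{\top}\|_*$ denotes its nuclear norm (sum of singular values). A one-hot vector has exactly one entry equal to $1$ and all others equal to $0$. This is multinomial logistic regression with $n$ samples, $m$ features and $c$ classes, with output feature matrix $XW^\top$. The line search is the algorithm of J.J. Moré and D.J. Thuente, "Line search algorithms with guaranteed sufficient decrease", ACM Trans. Math. Softw. 20(3) (1994) 286–307; the stepsizes it produces are taken to satisfy the Wolfe–Powell rules, i.e. a sufficient decrease condition and a curvature condition along the search direction $-\nabla G(W^k)$. *)

theory Defs
  imports "HOL-Analysis.Analysis"
begin

text \<open>Matrices are \<open>real^'cols^'rows\<close>, with the Frobenius inner product as \<open>\<bullet>\<close>;
  \<open>W $ j\<close> is the \<open>j\<close>-th row of \<open>W\<close>.\<close>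

text \<open>Singular values through pairs of unit singular vectors. Zero is a singular value iff both
  \<open>A\<close> and its transpose have a nontrivial kernel, i.e. iff \<open>A\<close> has rank less than
  the minimum of its two dimensions; this is the convention in which an \<open>n \<times> c\<close> matrix
  has \<open>min n c\<close> singular values.\<close>

definition singular_value :: "real^'b^'a \<Rightarrow> real \<Rightarrow> bool" where
  "singular_value A s \<longleftrightarrow> s \<ge> 0 \<and>
     (\<exists>u v. norm u = 1 \<and> norm v = 1 \<and> A *v v = s *\<^sub>R u \<and> transpose A *v u = s *\<^sub>R v)"

text \<open>The multiplicity of a singular value \<open>s > 0\<close>. At \<open>s = 0\<close> this counts the kernel
  of \<open>A\<close>, which is irrelevant below because the term is multiplied by \<open>s\<close>.\<close>

definition singular_value_mult :: "real^'b^'a \<Rightarrow> real \<Rightarrow> nat" where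
  "singular_value_mult A s = dim {v. (transpose A ** A) *v v = s\<^sup>2 *\<^sub>R v}"

definition nuclear_norm :: "real^'b^'a \<Rightarrow> real" where
  "nuclear_norm A = (\<Sum>s | singular_value A s. real (singular_value_mult A s) * s)"

text \<open>The index set of the sum is finite, so the sum is not the default value.\<close>

lemma finite_singular_values:
  fixes A :: "real^'b^'a"
  shows "finite {s. singular_value A s}"
proof -
  have "\<exists>v. singular_value A s \<longrightarrow> norm v = 1 \<and> (transpose A ** A) *v v = s\<^sup>2 *\<^sub>R v" for s
  proof (cases "singular_value A s")
    case True
    then obtain u v where "norm v = 1" "A *v v = s *\<^sub>R u" "transpose A *v u = s *\<^sub>R v"
      by (auto simp: singular_value_def)
    moreover from this have "(transpose A ** A) *v v = s\<^sup>2 *\<^sub>R v"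
      by (simp flip: matrix_vector_mul_assoc add: matrix_vector_mult_scaleR power2_eq_square)
    ultimately show ?thesis by blast
  qed simp
  then obtain v where v: "\<And>s. singular_value A s \<Longrightarrow> norm (v s) = 1"
    "\<And>s. singular_value A s \<Longrightarrow> (transpose A ** A) *v v s = s\<^sup>2 *\<^sub>R v s"
    by metis
  have orth: "v s \<bullet> v t = 0" if s: "singular_value A s" and t: "singular_value A t" and "s \<noteq> t" for s t
  proof -
    have "s\<^sup>2 * (v s \<bullet> v t) = ((transpose A ** A) *v v s) \<bullet> v t"
      using v(2)[OF s] by simp
    also have "\<dots> = v s \<bullet> ((transpose A ** A) *v v t)"
      by (metis dot_lmul_matrix matrix_transpose_mul transpose_matrix_vector transpose_transpose)
    also have "\<dots> = t\<^sup>2 * (v s \<bullet> v t)"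
      using v(2)[OF t] by simp
    finally have "(s\<^sup>2 - t\<^sup>2) * (v s \<bullet> v t) = 0" by (simp add: algebra_simps)
    moreover have "s\<^sup>2 \<noteq> t\<^sup>2"
      using s t \<open>s \<noteq> t\<close> by (auto simp: singular_value_def)
    ultimately show ?thesis by simp
  qed
  have nz: "v s \<bullet> v s \<noteq> 0" if "singular_value A s" for s
    using v(1)[OF that] by force
  have "inj_on v {s. singular_value A s}"
    using orth nz by (intro inj_onI) (metis mem_Collect_eq)
  moreover have "pairwise orthogonal (v ` {s. singular_value A s})"
    using orth by (auto simp: pairwise_def orthogonal_def)
  ultimately show ?thesis
    using pairwise_orthogonal_imp_finite finite_image_iff by blast
qed

definition hconcat :: "real^'a^'n \<Rightarrow> real^'b^'n \<Rightarrow> real^('a + 'b)^'n" where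
  "hconcat A B = (\<chi> i j. case j of Inl k \<Rightarrow> A $ i $ k | Inr k \<Rightarrow> B $ i $ k)"

definition one_hot :: "real^'c \<Rightarrow> bool" where
  "one_hot v \<longleftrightarrow> (\<exists>j. v $ j = 1 \<and> (\<forall>k. k \<noteq> j \<longrightarrow> v $ k = 0))"

definition data_matrix :: "('n \<Rightarrow> real^'m) \<Rightarrow> real^'m^'n" where
  "data_matrix x = (\<chi> i. x i)"

definition output_matrix :: "('n \<Rightarrow> real^'m) \<Rightarrow> real^'m^'c \<Rightarrow> real^'c^'n" where
  "output_matrix x W = data_matrix x ** transpose W"

definition logistic_loss :: "('n::finite \<Rightarrow> real^'m) \<Rightarrow> ('n \<Rightarrow> real^'c) \<Rightarrow> real^'m^'c \<Rightarrow> real" where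
  "logistic_loss x y W =
     - (1 / real CARD('n)) *
       (\<Sum>i\<in>UNIV. (\<Sum>j\<in>UNIV. y i $ j * ((W $ j) \<bullet> x i)) - ln (\<Sum>j\<in>UNIV. exp ((W $ j) \<bullet> x i)))"

definition objective ::
  "('n::finite \<Rightarrow> real^'m) \<Rightarrow> ('n \<Rightarrow> real^'c) \<Rightarrow> real \<Rightarrow> real^'m^'c \<Rightarrow> real" where
  "objective x y lam W =
     logistic_loss x y W + lam * nuclear_norm (hconcat (data_matrix x) (output_matrix x W))"

text \<open>Unspecified where \<open>f\<close> is not differentiable.\<close>

definition gradient :: "('a::real_inner \<Rightarrow> real) \<Rightarrow> 'a \<Rightarrow> 'a" where
  "gradient f w = (THE D. GDERIV f w :> D)"

text \<open>The Wolfe--Powell rules at \<open>w\<close> along the direction \<open>d\<close>: sufficient decrease with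
  parameter \<open>\<mu>\<close> and curvature with parameter \<open>\<eta>\<close>. With
  \<open>\<phi> a = f (w + a *\<^sub>R d)\<close> they read \<open>\<phi> a \<le> \<phi> 0 + \<mu> * a * \<phi>' 0\<close> and
  \<open>\<phi>' a \<ge> \<eta> * \<phi>' 0\<close>. The curvature condition \<open>\<bar>\<phi>' a\<bar> \<le> \<eta> * \<bar>\<phi>' 0\<bar>\<close>
  of More and Thuente, for a descent direction \<open>d\<close>, implies the latter.\<close>

definition wolfe_powell ::
  "real \<Rightarrow> real \<Rightarrow> ('a::real_inner \<Rightarrow> real) \<Rightarrow> 'a \<Rightarrow> 'a \<Rightarrow> real \<Rightarrow> bool" where
  "wolfe_powell \<mu> \<eta> f w d a \<longleftrightarrow>
     f (w + a *\<^sub>R d) \<le> f w + \<mu> * a * (gradient f w \<bullet> d) \<and>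
     gradient f (w + a *\<^sub>R d) \<bullet> d \<ge> \<eta> * (gradient f w \<bullet> d)"

definition accumulation_point :: "(nat \<Rightarrow> 'a::topological_space) \<Rightarrow> 'a \<Rightarrow> bool" where
  "accumulation_point W w \<longleftrightarrow> (\<exists>r. strict_mono r \<and> (W \<circ> r) \<longlonglongrightarrow> w)"

definition global_minimizer :: "('a \<Rightarrow> real) \<Rightarrow> 'a \<Rightarrow> bool" where
  "global_minimizer f w \<longleftrightarrow> (\<forall>v. f w \<le> f v)"

end

theory Submission
  imports Defs
begin

text \<open>The column space of \<open>[X, X W\<^sup>T]\<close> is that of \<open>X\<close>, whatever \<open>W\<close> is. Hence
  the rank never drops along the affine family \<open>W \<mapsto> [X, X W\<^sup>T]\<close>, and the nuclear norm is
  differentiable on it: at each \<open>W\<close> it is squeezed between the affine function given by the dual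
  certificate \<open>U V\<^sup>T\<close> and the quadratic function that comes from concavity of the square root.
  The affine lower bound also gives convexity, so the objective is convex and differentiable with
  a continuous gradient.

  If the gradient \<open>g\<close> at an accumulation point were nonzero, sufficient decrease would force the
  stepsizes along the subsequence to \<open>0\<close>. The next iterates then have the same limit, and the
  curvature condition becomes \<open>g \<bullet> g \<le> \<eta> * (g \<bullet> g)\<close> in the limit, which is
  impossible for \<open>\<eta> < 1\<close>.\<close>

subsection \<open>The spectral theorem and singular values\<close>

definition orthonormal_basis :: "'a::euclidean_space set \<Rightarrow> bool" where
  "orthonormal_basis E \<longleftrightarrow> pairwise orthogonal E \<and> (\<forall>e\<in>E. norm e = 1) \<and> span E = UNIV"

text \<open>The quadratic form \<open>x \<bullet> f x\<close> attains its maximum on the compact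
  unit sphere of \<open>S\<close>. At a maximiser the first variation vanishes, so the residual
  \<open>f e - \<nu> *\<^sub>R e\<close> is zero.\<close>

lemma symmetric_eigenvector_exists:
  fixes f :: "'a::euclidean_space \<Rightarrow> 'a"
  assumes lin: "linear f" and sym: "\<And>x y. f x \<bullet> y = x \<bullet> f y"
    and S: "subspace S" and inv: "f ` S \<subseteq> S" and nontriv: "S \<noteq> {0}"
  obtains e \<nu> where "e \<in> S" "norm e = 1" "f e = \<nu> *\<^sub>R e"
proof -
  interpret f: linear f by fact
  obtain z where z: "z \<in> S" "z \<noteq> 0"
    using nontriv subspace_0[OF S] by blast
  have "compact (S \<inter> sphere 0 1)"
    using closed_subspace[OF S] by (simp add: closed_Int_compact)
  moreover have "z /\<^sub>R norm z \<in> S \<inter> sphere 0 1"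
    using z S by (simp add: subspace_scale)
  then have "S \<inter> sphere 0 1 \<noteq> {}" by blast
  moreover have "continuous_on (S \<inter> sphere 0 1) (\<lambda>x. x \<bullet> f x)"
    using lin by (intro continuous_intros linear_continuous_on) (simp add: linear_conv_bounded_linear)
  ultimately obtain e where "e \<in> S \<inter> sphere 0 1" "\<forall>x\<in>S \<inter> sphere 0 1. x \<bullet> f x \<le> e \<bullet> f e"
    using continuous_attains_sup[of "S \<inter> sphere 0 1" "\<lambda>x. x \<bullet> f x"] by blast
  then have e: "e \<in> S" "norm e = 1"
    and emax: "\<And>x. x \<in> S \<Longrightarrow> norm x = 1 \<Longrightarrow> x \<bullet> f x \<le> e \<bullet> f e"
    by auto
  define \<nu> where "\<nu> = e \<bullet> f e"
  have quad: "x \<bullet> f x \<le> \<nu> * (x \<bullet> x)" if "x \<in> S" for x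
  proof (cases "x = 0")
    case False
    have "(x /\<^sub>R norm x) \<bullet> f (x /\<^sub>R norm x) \<le> \<nu>"
      unfolding \<nu>_def using False that S by (intro emax) (auto simp: subspace_scale)
    then have "(x \<bullet> f x) / (norm x)\<^sup>2 \<le> \<nu>"
      by (simp add: f.scaleR power2_eq_square divide_simps)
    with False show ?thesis by (simp add: divide_simps power2_norm_eq_inner)
  qed (simp add: f.zero)
  define d where "d = f e - \<nu> *\<^sub>R e"
  have dS: "d \<in> S"
    unfolding d_def using e inv S by (auto intro!: subspace_diff subspace_scale)
  \<comment> \<open>In \<open>quad\<close> at \<open>e + t *\<^sub>R d\<close> the first-order part
    is \<open>2 * t * (d \<bullet> d)\<close>; \<open>b\<close> collects the second-order
    terms.\<close>
  define b where "b = \<nu> * (d \<bullet> d) - d \<bullet> f d"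
  have b: "2 * (d \<bullet> d) \<le> t * b" if "t > 0" for t
  proof -
    have "e + t *\<^sub>R d \<in> S"
      using e dS S by (auto intro!: subspace_add subspace_scale)
    from quad[OF this]
    have "(e \<bullet> f e) + 2 * t * (d \<bullet> f e) + t\<^sup>2 * (d \<bullet> f d) \<le> \<nu> * ((e \<bullet> e) + 2 * t * (d \<bullet> e) + t\<^sup>2 * (d \<bullet> d))"
      using sym[of e d]
      by (simp add: f.add f.scaleR inner_add_left inner_add_right inner_commute power2_eq_square algebra_simps)
    moreover have "e \<bullet> e = 1" using e by (simp flip: power2_norm_eq_inner)
    ultimately have "2 * t * (d \<bullet> f e - \<nu> * (d \<bullet> e)) \<le> t * (t * b)"
      unfolding b_def by (simp add: \<nu>_def power2_eq_square algebra_simps)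
    moreover have "d \<bullet> f e - \<nu> * (d \<bullet> e) = d \<bullet> d"
      by (subst (3) d_def) (simp add: inner_diff_right)
    ultimately have "t * (2 * (d \<bullet> d)) \<le> t * (t * b)" by simp
    then show ?thesis using that by simp
  qed
  have "d \<bullet> d \<le> 0"
  proof (rule ccontr)
    assume "\<not> d \<bullet> d \<le> 0"
    then have d: "d \<bullet> d > 0" by auto
    \<comment> \<open>The choice \<open>t = 1\<close> makes \<open>b\<close> positive; then
      \<open>t = (d \<bullet> d) / b\<close> gives
      \<open>2 * (d \<bullet> d) \<le> d \<bullet> d\<close>.\<close>
    then have "b > 0" using b[of 1] by linarith
    then show False using b[of "(d \<bullet> d) / b"] d by simp
  qed
  then have "d = 0" by (metis antisym inner_eq_zero_iff inner_ge_zero)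
  then have "f e = \<nu> *\<^sub>R e" unfolding d_def by simp
  then show ?thesis using e that by blast
qed

text \<open>Induction on the dimension: split off one unit eigenvector. By self-adjointness its
  orthogonal complement inside \<open>S\<close> is again invariant, so the induction hypothesis
  supplies the other vectors.\<close>

lemma symmetric_eigenbasis_subspace:
  fixes f :: "'a::euclidean_space \<Rightarrow> 'a"
  assumes lin: "linear f" and sym: "\<And>x y. f x \<bullet> y = x \<bullet> f y"
    and "subspace S" "f ` S \<subseteq> S"
  shows "\<exists>E. pairwise orthogonal E \<and> (\<forall>e\<in>E. norm e = 1 \<and> (\<exists>\<nu>. f e = \<nu> *\<^sub>R e)) \<and> span E = S"
  using assms(3,4)
proof (induction "dim S" arbitrary: S rule: less_induct)
  case less
  interpret f: linear f by fact
  show ?case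
  proof (cases "S = {0}")
    case True
    then show ?thesis by (intro exI[of _ "{}"]) auto
  next
    case False
    obtain e \<nu> where e: "e \<in> S" "norm e = 1" "f e = \<nu> *\<^sub>R e"
      using symmetric_eigenvector_exists[OF lin sym less.prems False] by blast
    define S' where "S' = {x \<in> S. x \<bullet> e = 0}"
    have S': "subspace S'"
      using less.prems(1) unfolding subspace_def S'_def by (auto simp: inner_add_left)
    have "f ` S' \<subseteq> S'"
      using less.prems(2) sym[of _ e] unfolding S'_def by (auto simp: e(3))
    moreover have "dim S' < dim S"
    proof (rule dim_psubset)
      have "e \<notin> S'" unfolding S'_def using e by auto
      moreover have "S' \<subseteq> S" unfolding S'_def by blast
      moreover have "span S' = S'" "span S = S"
        using S' less.prems(1) by (simp_all add: span_eq_iff)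
      ultimately show "span S' \<subset> span S" using e(1) by blast
    qed
    ultimately obtain E where E: "pairwise orthogonal E" "span E = S'"
      "\<And>e. e \<in> E \<Longrightarrow> norm e = 1 \<and> (\<exists>\<nu>. f e = \<nu> *\<^sub>R e)"
      using less.hyps[of S'] S' by blast
    have "E \<subseteq> S'" using E(2) span_superset by blast
    then have orth: "\<And>x. x \<in> E \<Longrightarrow> x \<bullet> e = 0" by (auto simp: S'_def)
    have "pairwise orthogonal (insert e E)"
      using E(1) orth by (auto simp: pairwise_insert orthogonal_def inner_commute)
    moreover have "span (insert e E) = S"
    proof
      show "span (insert e E) \<subseteq> S"
        using \<open>E \<subseteq> S'\<close> e less.prems(1) by (intro span_minimal) (auto simp: S'_def)
      show "S \<subseteq> span (insert e E)"
      proof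
        fix x assume x: "x \<in> S"
        have "e \<bullet> e = 1" using e by (simp flip: power2_norm_eq_inner)
        then have "x - (x \<bullet> e) *\<^sub>R e \<in> S'"
          unfolding S'_def using x e less.prems(1)
          by (auto intro!: subspace_diff subspace_scale simp: inner_diff_left)
        then show "x \<in> span (insert e E)"
          using E(2) by (auto simp: span_insert)
      qed
    qed
    ultimately show ?thesis using e E(3) by (intro exI[of _ "insert e E"]) auto
  qed
qed

lemma symmetric_eigenbasis:
  fixes f :: "'a::euclidean_space \<Rightarrow> 'a"
  assumes "linear f" and "\<And>x y. f x \<bullet> y = x \<bullet> f y"
  obtains E where "orthonormal_basis E" "\<And>e. e \<in> E \<Longrightarrow> \<exists>\<nu>. f e = \<nu> *\<^sub>R e"
  using symmetric_eigenbasis_subspace[OF assms subspace_UNIV]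
  by (auto simp: orthonormal_basis_def)

section \<open>Coordinates in orthonormal families\<close>

lemma orthonormal_basis_finite: "orthonormal_basis E \<Longrightarrow> finite E"
  by (simp add: orthonormal_basis_def pairwise_orthogonal_imp_finite)

lemma orthonormal_basis_inner:
  assumes "orthonormal_basis E" "e \<in> E" "f \<in> E"
  shows "e \<bullet> f = (if e = f then 1 else 0)"
  using assms by (auto simp: orthonormal_basis_def pairwise_def orthogonal_def norm_eq_1)

lemma orthonormal_basis_sum:
  assumes "orthonormal_basis E"
  shows "(\<Sum>e\<in>E. (x \<bullet> e) *\<^sub>R e) = x"
  using orthonormal_basis_expand[of E x] assms orthonormal_basis_finite[OF assms]
  by (auto simp: orthonormal_basis_def)

lemma orthonormal_basis_eqI:
  assumes "orthonormal_basis E" "\<And>e. e \<in> E \<Longrightarrow> x \<bullet> e = y \<bullet> e"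
  shows "x = y"
proof -
  have "(\<Sum>e\<in>E. (x \<bullet> e) *\<^sub>R e) = (\<Sum>e\<in>E. (y \<bullet> e) *\<^sub>R e)"
    using assms(2) by (intro sum.cong) auto
  then show ?thesis by (simp add: orthonormal_basis_sum[OF assms(1)])
qed

text \<open>\<open>?p\<close> is the projection onto the span of the family:
  \<open>?p \<bullet> ?p\<close> and \<open>x \<bullet> ?p\<close> both equal the sum, and
  \<open>x - ?p\<close> has a nonnegative square.\<close>

lemma bessel_inequality:
  fixes u :: "'i \<Rightarrow> 'a::real_inner"
  assumes "finite I" and orth: "\<And>i j. i \<in> I \<Longrightarrow> j \<in> I \<Longrightarrow> u i \<bullet> u j = (if i = j then 1 else 0)"
  shows "(\<Sum>i\<in>I. (x \<bullet> u i)\<^sup>2) \<le> x \<bullet> x"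
proof -
  let ?p = "\<Sum>i\<in>I. (x \<bullet> u i) *\<^sub>R u i"
  have "?p \<bullet> ?p = (\<Sum>i\<in>I. \<Sum>j\<in>I. (x \<bullet> u i) * (x \<bullet> u j) * (u i \<bullet> u j))"
    by (simp add: inner_sum_left inner_sum_right algebra_simps inner_commute)
  also have "\<dots> = (\<Sum>i\<in>I. (x \<bullet> u i)\<^sup>2)"
    using \<open>finite I\<close> by (simp add: orth sum.delta if_distrib power2_eq_square cong: sum.cong if_cong)
  finally have pp: "?p \<bullet> ?p = (\<Sum>i\<in>I. (x \<bullet> u i)\<^sup>2)" .
  have xp: "x \<bullet> ?p = (\<Sum>i\<in>I. (x \<bullet> u i)\<^sup>2)"
    by (simp add: inner_sum_right power2_eq_square)
  have "0 \<le> (x - ?p) \<bullet> (x - ?p)" by simp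
  also have "\<dots> = x \<bullet> x - 2 * (x \<bullet> ?p) + ?p \<bullet> ?p"
    by (simp only: inner_diff_left inner_diff_right inner_commute[of ?p x])
  finally show ?thesis using pp xp by simp
qed

lemma bessel_equality:
  fixes u :: "'i \<Rightarrow> 'a::real_inner"
  assumes "finite I" and orth: "\<And>i j. i \<in> I \<Longrightarrow> j \<in> I \<Longrightarrow> u i \<bullet> u j = (if i = j then 1 else 0)"
    and x: "x = (\<Sum>i\<in>I. c i *\<^sub>R u i)"
  shows "(\<Sum>i\<in>I. (x \<bullet> u i)\<^sup>2) = x \<bullet> x"
proof -
  have xu: "x \<bullet> u j = c j" if "j \<in> I" for j
    using \<open>finite I\<close> that unfolding x by (simp add: inner_sum_left orth if_distrib cong: sum.cong if_cong)
  have "x \<bullet> x = (\<Sum>i\<in>I. c i * (x \<bullet> u i))"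
    by (subst (2) x) (simp add: inner_sum_right)
  then show ?thesis by (simp add: xu power2_eq_square)
qed

section \<open>Singular vectors and the nuclear norm\<close>

lemma transpose_inner:
  fixes A :: "real^'b^'a"
  shows "(transpose A *v u) \<bullet> v = u \<bullet> (A *v v)"
  by (metis dot_lmul_matrix transpose_matrix_vector)

lemma gram_inner:
  fixes A :: "real^'b^'a"
  shows "((transpose A ** A) *v x) \<bullet> y = (A *v x) \<bullet> (A *v y)"
  by (metis matrix_vector_mul_assoc transpose_inner)

text \<open>A full set of right singular vectors, kernel included. The singular values are not
  stored: the lengths of the images \<open>A *v e\<close> take their role.\<close>

definition singular_basis :: "real^'b^'a \<Rightarrow> (real^'b) set \<Rightarrow> bool" where
  "singular_basis A E \<longleftrightarrow> orthonormal_basis E \<and>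
     (\<forall>e\<in>E. \<forall>f\<in>E. e \<noteq> f \<longrightarrow> (A *v e) \<bullet> (A *v f) = 0)"

text \<open>An eigenbasis of the Gram map works, since \<open>(A *v e) \<bullet> (A *v f)\<close> is
  an eigenvalue times \<open>e \<bullet> f\<close>.\<close>

lemma singular_basis_exists:
  fixes A :: "real^'b^'a"
  obtains E where "singular_basis A E"
proof -
  obtain E where E: "orthonormal_basis E"
    and ev: "\<And>e. e \<in> E \<Longrightarrow> \<exists>\<nu>. (transpose A ** A) *v e = \<nu> *\<^sub>R e"
    using symmetric_eigenbasis[of "(*v) (transpose A ** A)"]
    by (metis gram_inner inner_commute matrix_vector_mul_linear)
  have "(A *v e) \<bullet> (A *v f) = 0" if "e \<in> E" "f \<in> E" "e \<noteq> f" for e f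
    using ev[OF that(1)] orthonormal_basis_inner[OF E that(1,2)] that(3)
    by (auto simp flip: gram_inner)
  then show ?thesis using E that unfolding singular_basis_def by blast
qed

lemma singular_basis_gram:
  fixes A :: "real^'b^'a"
  assumes "singular_basis A E" "e \<in> E"
  shows "(transpose A ** A) *v e = (norm (A *v e))\<^sup>2 *\<^sub>R e"
proof (rule orthonormal_basis_eqI[of E])
  show E: "orthonormal_basis E" using assms by (simp add: singular_basis_def)
  show "((transpose A ** A) *v e) \<bullet> f = ((norm (A *v e))\<^sup>2 *\<^sub>R e) \<bullet> f" if "f \<in> E" for f
    using assms that orthonormal_basis_inner[OF E assms(2) that]
    by (auto simp: gram_inner singular_basis_def power2_norm_eq_inner)
qed

text \<open>The eigenspace of the Gram map at \<open>s\<^sup>2\<close> is spanned by the basis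
  vectors whose images have length \<open>s\<close>. Every other basis vector has a different
  eigenvalue, so self-adjointness forces its coefficient to vanish.\<close>

lemma singular_value_mult_eq_card:
  fixes A :: "real^'b^'a"
  assumes E: "singular_basis A E" and s: "s > 0"
  shows "singular_value_mult A s = card {e \<in> E. norm (A *v e) = s}"
proof -
  let ?F = "{e \<in> E. norm (A *v e) = s}" and ?V = "{v. (transpose A ** A) *v v = s\<^sup>2 *\<^sub>R v}"
  have B: "orthonormal_basis E" using E by (simp add: singular_basis_def)
  have "subspace ?V"
    by (auto simp: subspace_def matrix_vector_right_distrib matrix_vector_mult_scaleR scaleR_add_right)
  moreover have "?F \<subseteq> ?V" using singular_basis_gram[OF E] by auto
  ultimately have "span ?F \<subseteq> ?V" by (simp add: span_minimal)
  moreover have "?V \<subseteq> span ?F"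
  proof
    fix v assume "v \<in> ?V"
    then have v: "(transpose A ** A) *v v = s\<^sup>2 *\<^sub>R v" by simp
    have "(v \<bullet> e) *\<^sub>R e \<in> span ?F" if e: "e \<in> E" for e
    proof (cases "norm (A *v e) = s")
      case True
      then show ?thesis using e by (auto intro: span_scale span_base)
    next
      case False
      have "s\<^sup>2 * (v \<bullet> e) = ((transpose A ** A) *v v) \<bullet> e" by (simp add: v)
      also have "\<dots> = v \<bullet> ((transpose A ** A) *v e)"
        by (metis gram_inner inner_commute)
      also have "\<dots> = (norm (A *v e))\<^sup>2 * (v \<bullet> e)"
        by (simp add: singular_basis_gram[OF E e])
      finally have "(s\<^sup>2 - (norm (A *v e))\<^sup>2) * (v \<bullet> e) = 0" by (simp add: algebra_simps)
      moreover have "s\<^sup>2 \<noteq> (norm (A *v e))\<^sup>2" using False s by simp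
      ultimately have "v \<bullet> e = 0" by simp
      then show ?thesis by (simp add: span_zero)
    qed
    then have "(\<Sum>e\<in>E. (v \<bullet> e) *\<^sub>R e) \<in> span ?F" by (intro span_sum) auto
    then show "v \<in> span ?F" by (simp add: orthonormal_basis_sum[OF B])
  qed
  ultimately have "?V = span ?F" by blast
  moreover have "independent ?F"
    using B by (intro pairwise_orthogonal_independent)
      (auto simp: orthonormal_basis_def pairwise_def)
  ultimately show ?thesis
    unfolding singular_value_mult_def by (simp add: dim_eq_card_independent)
qed

text \<open>Grouping the basis by the length of the images turns multiplicities into cardinalities
  of fibres.\<close>

lemma nuclear_norm_eq_sum:
  fixes A :: "real^'b^'a"
  assumes E: "singular_basis A E"
  shows "nuclear_norm A = (\<Sum>e\<in>E. norm (A *v e))"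
proof -
  let ?F = "\<lambda>s. {e \<in> E. norm (A *v e) = s}" and ?T = "(\<lambda>e. norm (A *v e)) ` E"
  have B: "orthonormal_basis E" and fin: "finite E"
    using E by (auto simp: singular_basis_def orthonormal_basis_finite)
  \<comment> \<open>Only positive lengths are claimed: \<open>0\<close> can occur as a length
    without being a singular value, which would also require a kernel vector of the
    transpose.\<close>
  have sv: "singular_value A s" if "s \<in> ?T" "s > 0" for s
  proof -
    obtain e where e: "e \<in> E" "norm (A *v e) = s" using \<open>s \<in> ?T\<close> by blast
    have "transpose A *v (A *v e) = s\<^sup>2 *\<^sub>R e"
      using singular_basis_gram[OF E e(1)] e(2) by (simp add: matrix_vector_mul_assoc)
    then show ?thesis
      unfolding singular_value_def using e B \<open>s > 0\<close>
      by (intro conjI exI[of _ "(A *v e) /\<^sub>R s"] exI[of _ e])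
        (auto simp: orthonormal_basis_def matrix_vector_mult_scaleR power2_eq_square)
  qed
  have "nuclear_norm A = (\<Sum>s | singular_value A s. real (card (?F s)) * s)"
    unfolding nuclear_norm_def
  proof (rule sum.cong)
    fix s assume "s \<in> {s. singular_value A s}"
    then have "s \<ge> 0" by (simp add: singular_value_def)
    then show "real (singular_value_mult A s) * s = real (card (?F s)) * s"
      using singular_value_mult_eq_card[OF E, of s] by (cases "s = 0") auto
  qed simp
  \<comment> \<open>The index sets can differ only in null terms: a length that is no singular value
    is \<open>0\<close>, and a singular value that is no length has an empty fibre.\<close>
  also have "\<dots> = (\<Sum>s\<in>?T. real (card (?F s)) * s)"
  proof (rule sum.mono_neutral_cong)
    show "real (card (?F s)) * s = 0" if "s \<in> ?T - {s. singular_value A s}" for s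
      using sv[of s] that by force
    show "real (card (?F s)) * s = 0" if "s \<in> {s. singular_value A s} - ?T" for s
    proof -
      have "?F s = {}" using that by blast
      then show ?thesis by (simp only: card.empty)
    qed
  qed (use fin finite_singular_values[of A] in auto)
  also have "\<dots> = (\<Sum>s\<in>?T. \<Sum>e\<in>?F s. norm (A *v e))"
    by (intro sum.cong) auto
  also have "\<dots> = (\<Sum>e\<in>E. norm (A *v e))"
    using sum.image_gen[OF fin, of "\<lambda>e. norm (A *v e)" "\<lambda>e. norm (A *v e)"] by simp
  finally show ?thesis .
qed

text \<open>A reduced singular value decomposition. The right singular vectors themselves form the
  index set \<open>I\<close>, so a repeated singular value simply occurs at several indices.\<close>

definition singular_system ::
  "real^'b^'a \<Rightarrow> (real^'b) set \<Rightarrow> (real^'b \<Rightarrow> real) \<Rightarrow> (real^'b \<Rightarrow> real^'a) \<Rightarrow> bool" where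
  "singular_system A I s u \<longleftrightarrow> finite I \<and> (\<forall>i\<in>I. s i > 0) \<and>
     (\<forall>i\<in>I. \<forall>j\<in>I. i \<bullet> j = (if i = j then 1 else 0)) \<and>
     (\<forall>i\<in>I. \<forall>j\<in>I. u i \<bullet> u j = (if i = j then 1 else 0)) \<and>
     (\<forall>i\<in>I. A *v i = s i *\<^sub>R u i) \<and>
     (\<forall>i\<in>I. transpose A *v u i = s i *\<^sub>R i) \<and>
     (\<forall>v. A *v v = (\<Sum>i\<in>I. (s i * (v \<bullet> i)) *\<^sub>R u i)) \<and>
     nuclear_norm A = (\<Sum>i\<in>I. s i)"

lemma singular_systemD:
  assumes "singular_system A I s u"
  shows "finite I" "\<And>i. i \<in> I \<Longrightarrow> s i > 0"
    "\<And>i j. i \<in> I \<Longrightarrow> j \<in> I \<Longrightarrow> i \<bullet> j = (if i = j then 1 else 0)"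
    "\<And>i j. i \<in> I \<Longrightarrow> j \<in> I \<Longrightarrow> u i \<bullet> u j = (if i = j then 1 else 0)"
    "\<And>i. i \<in> I \<Longrightarrow> A *v i = s i *\<^sub>R u i"
    "\<And>i. i \<in> I \<Longrightarrow> transpose A *v u i = s i *\<^sub>R i"
    "\<And>v. A *v v = (\<Sum>i\<in>I. (s i * (v \<bullet> i)) *\<^sub>R u i)"
    "nuclear_norm A = (\<Sum>i\<in>I. s i)"
  using assms unfolding singular_system_def by blast+

lemma singular_system_exists:
  fixes A :: "real^'b^'a"
  obtains I s u where "singular_system A I s u"
proof -
  obtain E where E: "singular_basis A E" by (rule singular_basis_exists)
  then have B: "orthonormal_basis E" and fin: "finite E"
    by (auto simp: singular_basis_def orthonormal_basis_finite)
  define I where "I = {e \<in> E. A *v e \<noteq> 0}"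
  define s where "s e = norm (A *v e)" for e
  define u where "u e = (A *v e) /\<^sub>R s e" for e
  have IE: "I \<subseteq> E" and finI: "finite I" using fin by (auto simp: I_def)
  have s: "s e > 0" if "e \<in> I" for e using that by (simp add: I_def s_def)
  have Ae: "A *v e = s e *\<^sub>R u e" if "e \<in> I" for e
    using s[OF that] by (simp add: u_def)
  have orth: "u e \<bullet> u f = (if e = f then 1 else 0)" if "e \<in> I" "f \<in> I" for e f
  proof (cases "e = f")
    case True
    have "norm (u e) = 1" using s[OF \<open>e \<in> I\<close>] by (simp add: u_def s_def)
    then show ?thesis using True by (simp add: norm_eq_1)
  next
    case False
    then have "(A *v e) \<bullet> (A *v f) = 0"
      using that E IE by (auto simp: singular_basis_def)
    then show ?thesis using False by (simp add: u_def)
  qed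
  have trans: "transpose A *v u e = s e *\<^sub>R e" if "e \<in> I" for e
  proof -
    have "transpose A *v (A *v e) = (s e)\<^sup>2 *\<^sub>R e"
      using singular_basis_gram[OF E, of e] that IE by (auto simp: s_def matrix_vector_mul_assoc)
    then show ?thesis
      using s[OF that] by (simp add: u_def matrix_vector_mult_scaleR power2_eq_square)
  qed
  have expand: "A *v v = (\<Sum>i\<in>I. (s i * (v \<bullet> i)) *\<^sub>R u i)" for v
  proof -
    have "A *v v = A *v (\<Sum>e\<in>E. (v \<bullet> e) *\<^sub>R e)"
      by (simp add: orthonormal_basis_sum[OF B])
    also have "\<dots> = (\<Sum>e\<in>E. (v \<bullet> e) *\<^sub>R (A *v e))"
      by (simp add: linear_sum[OF matrix_vector_mul_linear] matrix_vector_mult_scaleR)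
    also have "\<dots> = (\<Sum>e\<in>I. (v \<bullet> e) *\<^sub>R (A *v e))"
      using fin by (intro sum.mono_neutral_right) (auto simp: I_def)
    also have "\<dots> = (\<Sum>i\<in>I. (s i * (v \<bullet> i)) *\<^sub>R u i)"
      by (intro sum.cong) (auto simp: Ae)
    finally show ?thesis .
  qed
  have nuc: "nuclear_norm A = (\<Sum>i\<in>I. s i)"
    unfolding nuclear_norm_eq_sum[OF E] s_def
    using fin by (intro sum.mono_neutral_right) (auto simp: I_def)
  have "e \<bullet> f = (if e = f then 1 else 0)" if "e \<in> I" "f \<in> I" for e f
    using orthonormal_basis_inner[OF B] that IE by blast
  then have "singular_system A I s u"
    unfolding singular_system_def using finI s orth Ae trans expand nuc by blast
  then show ?thesis by (rule that)
qed

section \<open>Two-sided bounds for the nuclear norm\<close>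

text \<open>Duality of nuclear and operator norm: the left-hand side pairs \<open>A\<close> with the
  partial isometry sending each \<open>v i\<close> to \<open>u i\<close>. When \<open>A\<close> is
  expanded in its own singular system, every singular value gets a weight of at most
  \<open>1\<close>, by Cauchy-Schwarz and Bessel.\<close>

lemma nuclear_norm_dual_bound:
  fixes A :: "real^'b^'a" and v :: "'i \<Rightarrow> real^'b" and u :: "'i \<Rightarrow> real^'a"
  assumes "finite I"
    and v: "\<And>i j. i \<in> I \<Longrightarrow> j \<in> I \<Longrightarrow> v i \<bullet> v j = (if i = j then 1 else 0)"
    and u: "\<And>i j. i \<in> I \<Longrightarrow> j \<in> I \<Longrightarrow> u i \<bullet> u j = (if i = j then 1 else 0)"
  shows "(\<Sum>i\<in>I. u i \<bullet> (A *v v i)) \<le> nuclear_norm A"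
proof -
  obtain J t w where "singular_system A J t w" by (rule singular_system_exists)
  note J = singular_systemD[OF this]
  have le1: "(\<Sum>i\<in>I. (w j \<bullet> u i) * (j \<bullet> v i)) \<le> 1" if "j \<in> J" for j
  proof -
    have "(\<Sum>i\<in>I. (w j \<bullet> u i) * (j \<bullet> v i))\<^sup>2 \<le> (\<Sum>i\<in>I. (w j \<bullet> u i)\<^sup>2) * (\<Sum>i\<in>I. (j \<bullet> v i)\<^sup>2)"
      by (rule Cauchy_Schwarz_ineq_sum)
    also have "\<dots> \<le> (w j \<bullet> w j) * (j \<bullet> j)"
      using bessel_inequality[OF assms(1) u] bessel_inequality[OF assms(1) v]
      by (intro mult_mono) (auto intro: sum_nonneg)
    also have "\<dots> = 1\<^sup>2" using J(3)[OF that that] J(4)[OF that that] by simp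
    finally show ?thesis by (rule power2_le_imp_le) simp
  qed
  have "(\<Sum>i\<in>I. u i \<bullet> (A *v v i)) = (\<Sum>i\<in>I. \<Sum>j\<in>J. t j * ((w j \<bullet> u i) * (j \<bullet> v i)))"
    unfolding J(7) by (simp add: inner_sum_right inner_commute mult_ac)
  also have "\<dots> = (\<Sum>j\<in>J. t j * (\<Sum>i\<in>I. (w j \<bullet> u i) * (j \<bullet> v i)))"
    by (subst sum.swap) (simp add: sum_distrib_left)
  also have "\<dots> \<le> (\<Sum>j\<in>J. t j)"
    using J(2) le1 by (intro sum_mono) (simp add: mult_left_le less_imp_le)
  finally show ?thesis using J(8) by simp
qed

text \<open>When \<open>s i\<close> and \<open>u i\<close> are the positive singular values and left singular vectors
  of a matrix \<open>B\<close>, the right-hand side is the linearisation at \<open>B B\<^sup>T\<close> of the concave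
  function \<open>P \<mapsto> 2 tr (sqrt P)\<close>, evaluated at \<open>P = A A\<^sup>T\<close>.\<close>

lemma nuclear_norm_quadratic_bound:
  fixes A :: "real^'b^'a" and u :: "'i \<Rightarrow> real^'a"
  assumes "finite I" and s: "\<And>i. i \<in> I \<Longrightarrow> s i > 0"
    and u: "\<And>i j. i \<in> I \<Longrightarrow> j \<in> I \<Longrightarrow> u i \<bullet> u j = (if i = j then 1 else 0)"
    and range: "\<And>v. \<exists>c. A *v v = (\<Sum>i\<in>I. c i *\<^sub>R u i)"
  shows "2 * nuclear_norm A \<le> (\<Sum>i\<in>I. s i) + (\<Sum>i\<in>I. (norm (transpose A *v u i))\<^sup>2 / s i)"
proof -
  obtain J t w where "singular_system A J t w" by (rule singular_system_exists)
  note J = singular_systemD[OF this]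
  \<comment> \<open>The hypothesis on the range puts each \<open>w j\<close> into the span of the
    \<open>u i\<close>, where Bessel's inequality is an equality.\<close>
  have one: "(\<Sum>i\<in>I. (w j \<bullet> u i)\<^sup>2) = 1" if j: "j \<in> J" for j
  proof -
    obtain c where c: "A *v j = (\<Sum>i\<in>I. c i *\<^sub>R u i)" using range by blast
    have "w j = (A *v j) /\<^sub>R t j" using J(2,5)[OF j] by simp
    then have "w j = (\<Sum>i\<in>I. (c i / t j) *\<^sub>R u i)"
      by (simp add: c scaleR_sum_right divide_inverse mult.commute)
    from bessel_equality[OF assms(1) u this] show ?thesis using J(4)[OF j j] by simp
  qed
  have sq: "(norm (transpose A *v x))\<^sup>2 = (\<Sum>j\<in>J. (t j)\<^sup>2 * (w j \<bullet> x)\<^sup>2)" for x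
  proof -
    have "(norm (transpose A *v x))\<^sup>2 = x \<bullet> (A *v (transpose A *v x))"
      by (simp add: power2_norm_eq_inner transpose_inner del: transpose_matrix_vector)
    also have "\<dots> = (\<Sum>j\<in>J. t j * ((transpose A *v x) \<bullet> j) * (x \<bullet> w j))"
      by (subst J(7)) (simp add: inner_sum_right)
    also have "\<dots> = (\<Sum>j\<in>J. (t j)\<^sup>2 * (w j \<bullet> x)\<^sup>2)"
    proof (rule sum.cong)
      fix j assume "j \<in> J"
      then have "(transpose A *v x) \<bullet> j = t j * (x \<bullet> w j)"
        by (simp only: transpose_inner J(5) inner_scaleR_right)
      then show "t j * ((transpose A *v x) \<bullet> j) * (x \<bullet> w j) = (t j)\<^sup>2 * (w j \<bullet> x)\<^sup>2"
        by (simp only: inner_commute[of x] power2_eq_square mult_ac)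
    qed simp
    finally show ?thesis .
  qed
  \<comment> \<open>The scalar form of the linearisation: twice the square root lies below its
    tangent at \<open>(s i)\<^sup>2\<close>.\<close>
  have amgm: "2 * t j \<le> s i + (t j)\<^sup>2 / s i" if "i \<in> I" for i j
  proof -
    have "0 \<le> (s i - t j)\<^sup>2 / s i" using s[OF that] by simp
    also have "\<dots> = s i + (t j)\<^sup>2 / s i - 2 * t j"
      using s[OF that] by (simp add: power2_eq_square field_simps)
    finally show ?thesis by simp
  qed
  \<comment> \<open>The squares \<open>(w j \<bullet> u i)\<^sup>2\<close> act as weights. Their sum
    over \<open>i\<close> is exactly \<open>1\<close>, so they can be inserted here; their sum over
    \<open>j\<close> is at most \<open>1\<close>, which closes the chain.\<close>
  have "2 * nuclear_norm A = (\<Sum>j\<in>J. (2 * t j) * (\<Sum>i\<in>I. (w j \<bullet> u i)\<^sup>2))"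
    by (simp add: J(8) one sum_distrib_left)
  also have "\<dots> = (\<Sum>j\<in>J. \<Sum>i\<in>I. (2 * t j) * (w j \<bullet> u i)\<^sup>2)"
    by (simp add: sum_distrib_left)
  also have "\<dots> \<le> (\<Sum>j\<in>J. \<Sum>i\<in>I. (s i + (t j)\<^sup>2 / s i) * (w j \<bullet> u i)\<^sup>2)"
    using amgm by (intro sum_mono mult_right_mono) auto
  also have "\<dots> = (\<Sum>i\<in>I. \<Sum>j\<in>J. (s i + (t j)\<^sup>2 / s i) * (w j \<bullet> u i)\<^sup>2)"
    by (rule sum.swap)
  also have "\<dots> = (\<Sum>i\<in>I. s i * (\<Sum>j\<in>J. (u i \<bullet> w j)\<^sup>2) + (norm (transpose A *v u i))\<^sup>2 / s i)"
    by (simp add: sq sum_distrib_left sum_divide_distrib ring_distribs sum.distrib inner_commute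
        del: transpose_matrix_vector)
  also have "\<dots> \<le> (\<Sum>i\<in>I. s i * 1 + (norm (transpose A *v u i))\<^sup>2 / s i)"
    using bessel_inequality[OF J(1,4)] u s
    by (intro sum_mono add_right_mono mult_left_mono) (metis, simp add: less_imp_le)
  finally show ?thesis by (simp add: sum.distrib)
qed

text \<open>\<open>T\<close> pairs \<open>D\<close> with the certificate \<open>U V\<^sup>T\<close>
  built from the singular vectors of \<open>A\<close>. It is a subgradient in every direction; when
  the column space does not grow, the quadratic bound gives a matching upper estimate.\<close>

lemma nuclear_norm_expansion:
  fixes A :: "real^'b^'a"
  obtains T :: "real^'b^'a \<Rightarrow> real" and C where "linear T" "C \<ge> 0"
    "\<And>D. nuclear_norm A + T D \<le> nuclear_norm (A + D)"
    "\<And>D. range ((*v) (A + D)) \<subseteq> range ((*v) A) \<Longrightarrow>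
       nuclear_norm (A + D) \<le> nuclear_norm A + T D + C * (norm D)\<^sup>2"
proof -
  obtain I s u where "singular_system A I s u" by (rule singular_system_exists)
  note I = singular_systemD[OF this]
  define T where "T D = (\<Sum>i\<in>I. u i \<bullet> (D *v i))" for D :: "real^'b^'a"
  define K where "K i = onorm (\<lambda>D :: real^'b^'a. transpose D *v u i)" for i
  \<comment> \<open>The division by \<open>2\<close> undoes the factor in front of the nuclear norm
    in the quadratic bound.\<close>
  define C where "C = (\<Sum>i\<in>I. (K i)\<^sup>2 / s i) / 2"
  have lin: "linear T"
    unfolding T_def
    by (intro linearI) (simp_all add: matrix_vector_mult_add_rdistrib inner_add_right sum.distrib
        scaleR_matrix_vector_assoc[symmetric] sum_distrib_left)
  have "T A = nuclear_norm A"
    by (simp add: T_def I(4,5,8))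
  then have lower: "nuclear_norm A + T D \<le> nuclear_norm (A + D)" for D
    using nuclear_norm_dual_bound[OF I(1,3,4), of "A + D"] linear_add[OF lin, of A D]
    by (simp add: T_def)
  have K: "norm (transpose D *v u i) \<le> K i * norm D" for i and D :: "real^'b^'a"
    unfolding K_def
  proof (rule onorm)
    have "linear (\<lambda>D :: real^'b^'a. transpose D *v u i)"
      by (intro linearI) (simp_all add: vector_matrix_mult_def vec_eq_iff algebra_simps sum.distrib sum_distrib_left)
    then show "bounded_linear (\<lambda>D :: real^'b^'a. transpose D *v u i)"
      by (simp add: linear_conv_bounded_linear)
  qed
  have upper: "nuclear_norm (A + D) \<le> nuclear_norm A + T D + C * (norm D)\<^sup>2"
    if "range ((*v) (A + D)) \<subseteq> range ((*v) A)" for D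
  proof -
    have "\<exists>c. (A + D) *v v = (\<Sum>i\<in>I. c i *\<^sub>R u i)" for v
    proof -
      obtain z where "(A + D) *v v = A *v z" using \<open>range _ \<subseteq> _\<close> by blast
      then show ?thesis using I(7)[of z] by (intro exI[of _ "\<lambda>i. s i * (z \<bullet> i)"]) simp
    qed
    note nuclear_norm_quadratic_bound[where u = u and s = s, OF I(1,2,4) this]
    \<comment> \<open>Expand the square of \<open>s i *\<^sub>R i + transpose D *v u i\<close> and
      divide by \<open>s i\<close>. Summed over \<open>I\<close>, the leading terms give the nuclear
      norm of \<open>A\<close> and the cross terms give \<open>2 * T D\<close>.\<close>
    moreover have "(norm (transpose (A + D) *v u i))\<^sup>2 / s i
        \<le> s i + 2 * (u i \<bullet> (D *v i)) + (K i)\<^sup>2 / s i * (norm D)\<^sup>2" if i: "i \<in> I" for i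
    proof -
      have "transpose (A + D) *v u i = transpose A *v u i + transpose D *v u i"
        by (simp add: vector_matrix_mult_def vec_eq_iff algebra_simps sum.distrib)
      then have "(norm (transpose (A + D) *v u i))\<^sup>2
          = (s i)\<^sup>2 + 2 * s i * (u i \<bullet> (D *v i)) + (norm (transpose D *v u i))\<^sup>2"
        using I(3)[OF i i] transpose_inner[of D "u i" i]
        by (simp add: I(6)[OF i] power2_norm_eq_inner inner_add_left inner_add_right inner_commute
            del: transpose_matrix_vector) (simp add: power2_eq_square)
      also have "\<dots> \<le> (s i)\<^sup>2 + 2 * s i * (u i \<bullet> (D *v i)) + (K i * norm D)\<^sup>2"
        by (intro add_left_mono power_mono K norm_ge_zero)
      finally show ?thesis
        using I(2)[OF i] by (simp add: field_simps power2_eq_square)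
    qed
    then have "(\<Sum>i\<in>I. (norm (transpose (A + D) *v u i))\<^sup>2 / s i)
        \<le> (\<Sum>i\<in>I. s i + 2 * (u i \<bullet> (D *v i)) + (K i)\<^sup>2 / s i * (norm D)\<^sup>2)"
      by (rule sum_mono)
    ultimately show ?thesis
      unfolding T_def C_def I(8)
      by (simp add: sum.distrib sum_distrib_left[symmetric] sum_distrib_right[symmetric]
          del: times_divide_eq_left times_divide_eq_right)
  qed
  have "C \<ge> 0"
    unfolding C_def using I(2) by (intro divide_nonneg_nonneg sum_nonneg) (auto simp: less_imp_le)
  then show ?thesis using that lin lower upper by blast
qed

subsection \<open>Convex differentiable functions and the Wolfe--Powell rules\<close>

text \<open>Differentiability and a supporting affine minorant in one predicate. Required at every
  point, it says that \<open>f\<close> is convex and differentiable, and it passes through sums,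
  nonnegative multiples and linear substitutions.\<close>

definition tangent_below :: "('a::real_normed_vector \<Rightarrow> real) \<Rightarrow> 'a \<Rightarrow> ('a \<Rightarrow> real) \<Rightarrow> bool" where
  "tangent_below f w T \<longleftrightarrow> (f has_derivative T) (at w) \<and> (\<forall>v. f w + T (v - w) \<le> f v)"

lemma tangent_below_linear:
  fixes f :: "'a::euclidean_space \<Rightarrow> real"
  assumes "linear f"
  shows "tangent_below f w f"
  using assms
  by (simp add: tangent_below_def linear_diff bounded_linear_imp_has_derivative
      linear_conv_bounded_linear[symmetric])

lemma tangent_below_add:
  assumes "tangent_below f w T" "tangent_below g w U"
  shows "tangent_below (\<lambda>x. f x + g x) w (\<lambda>h. T h + U h)"
proof -
  have "f w + g w + (T (v - w) + U (v - w)) \<le> f v + g v" for v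
    using assms unfolding tangent_below_def by (smt (verit))
  then show ?thesis using assms by (simp add: tangent_below_def has_derivative_add)
qed

lemma tangent_below_sum:
  assumes "\<And>i. i \<in> I \<Longrightarrow> tangent_below (f i) w (T i)"
  shows "tangent_below (\<lambda>x. \<Sum>i\<in>I. f i x) w (\<lambda>h. \<Sum>i\<in>I. T i h)"
proof -
  have "(\<Sum>i\<in>I. f i w) + (\<Sum>i\<in>I. T i (v - w)) \<le> (\<Sum>i\<in>I. f i v)" for v
    unfolding sum.distrib[symmetric] using assms by (intro sum_mono) (simp add: tangent_below_def)
  then show ?thesis using assms by (simp add: tangent_below_def has_derivative_sum)
qed

lemma tangent_below_scale:
  assumes "tangent_below f w T" "c \<ge> 0"
  shows "tangent_below (\<lambda>x. c * f x) w (\<lambda>h. c * T h)"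
proof -
  have "c * f w + c * T (v - w) \<le> c * f v" for v
    unfolding distrib_left[symmetric] using assms by (intro mult_left_mono) (simp_all add: tangent_below_def)
  then show ?thesis using assms by (simp add: tangent_below_def has_derivative_mult_right)
qed

lemma tangent_below_compose_linear:
  fixes L :: "'a::euclidean_space \<Rightarrow> 'b::real_normed_vector"
  assumes "tangent_below f (L w) T" "linear L"
  shows "tangent_below (\<lambda>x. f (L x)) w (\<lambda>h. T (L h))"
proof -
  have "(L has_derivative L) (at w)"
    using assms(2) by (simp add: bounded_linear_imp_has_derivative linear_conv_bounded_linear[symmetric])
  then have "((\<lambda>x. f (L x)) has_derivative (\<lambda>h. T (L h))) (at w)"
    using assms(1) by (auto simp: tangent_below_def intro: has_derivative_compose)
  then show ?thesis
    using assms by (simp add: tangent_below_def linear_diff)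
qed

text \<open>The remainder lies between \<open>0\<close> and a multiple of
  \<open>(norm (v - w))\<^sup>2\<close>, hence is of smaller order than
  \<open>norm (v - w)\<close>.\<close>

lemma tangent_below_squeeze:
  fixes f :: "'a::euclidean_space \<Rightarrow> real"
  assumes "linear T" "C \<ge> 0" and lower: "\<And>v. f w + T (v - w) \<le> f v"
    and upper: "\<And>v. f v \<le> f w + T (v - w) + C * (norm (v - w))\<^sup>2"
  shows "tangent_below f w T"
  unfolding tangent_below_def
proof
  show "(f has_derivative T) (at w)"
  proof (rule has_derivativeI_sandwich[of 1])
    show "bounded_linear T" using assms(1) by (simp add: linear_conv_bounded_linear)
    show "norm (f y - f w - T (y - w)) / norm (y - w) \<le> C * norm (y - w)" if "y \<noteq> w" for y
    proof -
      have "norm (f y - f w - T (y - w)) \<le> C * (norm (y - w))\<^sup>2"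
        using lower[of y] upper[of y] by simp
      then show ?thesis using that by (simp add: divide_simps power2_eq_square mult_ac)
    qed
    show "((\<lambda>y. C * norm (y - w)) \<longlongrightarrow> 0) (at w)"
      by (rule tendsto_eq_intros | simp)+
  qed simp
qed (use lower in blast)

section \<open>Gradients and their continuity\<close>

text \<open>Riesz representation: \<open>adjoint T 1\<close> is the vector representing the
  functional \<open>T\<close>, and uniqueness of derivatives makes the description in
  \<open>gradient\<close> well defined.\<close>

lemma tangent_below_gradient:
  fixes f :: "'a::euclidean_space \<Rightarrow> real"
  assumes "tangent_below f w T"
  shows "GDERIV f w :> gradient f w" "f w + (v - w) \<bullet> gradient f w \<le> f v"
proof -
  interpret bounded_linear T
    using assms by (auto simp: tangent_below_def intro: has_derivative_bounded_linear)
  define D where "D = adjoint T 1"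
  have T: "T = (\<lambda>h. h \<bullet> D)"
    using adjoint_works[OF linear_axioms, of _ 1] by (simp add: D_def fun_eq_iff)
  have D: "GDERIV f w :> D"
    using assms by (simp add: tangent_below_def gderiv_def T)
  have unique: "D' = D" if "GDERIV f w :> D'" for D'
  proof -
    have "(\<lambda>h. h \<bullet> D') = (\<lambda>h. h \<bullet> D)"
      using D that has_derivative_unique by (auto simp: gderiv_def)
    then show ?thesis by (metis vector_eq_ldot)
  qed
  have "gradient f w = D"
    unfolding gradient_def using D unique by (rule the_equality)
  then show "GDERIV f w :> gradient f w" "f w + (v - w) \<bullet> gradient f w \<le> f v"
    using D assms by (auto simp: tangent_below_def T)
qed

text \<open>For \<open>w\<close> near \<open>a\<close>, compare the tangent inequality at \<open>w\<close> with the expansion of \<open>f\<close> at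
  \<open>a\<close> in the direction in which the gradients differ.\<close>

lemma convex_gradient_continuous:
  fixes f :: "'a::euclidean_space \<Rightarrow> real"
  assumes tb: "\<And>w. \<exists>T. tangent_below f w T"
  shows "isCont (gradient f) a"
proof -
  note grad = tangent_below_gradient[OF someI_ex[OF tb]]
  have "\<exists>d>0. \<forall>w. dist w a < d \<longrightarrow> dist (gradient f w) (gradient f a) < e" if "e > 0" for e
  proof -
    obtain d where d: "d > 0" and near: "\<And>v. norm (v - a) < d \<Longrightarrow>
        norm (f v - f a - (v - a) \<bullet> gradient f a) \<le> (e / 3) * norm (v - a)"
      using grad(1)[of a] \<open>e > 0\<close> unfolding gderiv_def has_derivative_at_alt
      by (meson divide_pos_pos zero_less_numeral)
    have "norm (gradient f w - gradient f a) < e" if w: "norm (w - a) < d / 3" for w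
    proof (cases "gradient f w = gradient f a")
      case False
      define p where "p = gradient f w - gradient f a"
      \<comment> \<open>The length \<open>d / 3\<close> keeps \<open>w + z\<close> within
        \<open>2 * d / 3\<close> of \<open>a\<close>, and the direction of \<open>p\<close> makes
        \<open>z \<bullet> p\<close> as large as that length permits.\<close>
      define z where "z = (d / 3 / norm p) *\<^sub>R p"
      have p: "norm p > 0" using False by (simp add: p_def)
      have z: "norm z = d / 3" "z \<bullet> p = d / 3 * norm p"
        using p d by (simp_all add: z_def dot_square_norm power2_eq_square)
      have near': "norm (w + z - a) \<le> 2 * d / 3"
        using norm_triangle_ineq[of "w - a" z] w z(1) by (simp add: algebra_simps)
      \<comment> \<open>Three estimates are chained: the minorant at \<open>w\<close> evaluated at
        \<open>w + z\<close>, the minorant at \<open>a\<close> evaluated at \<open>w\<close>, and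
        the expansion at \<open>a\<close> evaluated at \<open>w + z\<close>. The function values
        cancel, leaving a bound on \<open>z \<bullet> p\<close>.\<close>
      have "f w + z \<bullet> gradient f w \<le> f (w + z)"
        using grad(2)[of w "w + z"] by simp
      moreover have "f a + (w - a) \<bullet> gradient f a \<le> f w" by (rule grad(2))
      moreover have "f (w + z) \<le> f a + (w + z - a) \<bullet> gradient f a + (e / 3) * norm (w + z - a)"
      proof -
        have "norm (w + z - a) < d" using near' d by linarith
        from near[OF this] show ?thesis unfolding real_norm_def by linarith
      qed
      moreover have "(w + z - a) \<bullet> gradient f a = (w - a) \<bullet> gradient f a + z \<bullet> gradient f a"
        by (simp add: inner_add_left inner_diff_left)
      ultimately have "z \<bullet> p \<le> (e / 3) * norm (w + z - a)"
        by (simp add: p_def inner_diff_right)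
      also have "\<dots> \<le> (e / 3) * (2 * d / 3)"
        using near' \<open>e > 0\<close> by (intro mult_left_mono) auto
      finally have "d * norm p \<le> d * (2 * e / 3)" by (simp add: z(2) field_simps)
      then have "norm p \<le> 2 * e / 3" using d by simp
      then show ?thesis using \<open>e > 0\<close> by (simp add: p_def)
    qed (use \<open>e > 0\<close> in simp)
    then show ?thesis using d by (intro exI[of _ "d / 3"]) (simp add: dist_norm)
  qed
  then show ?thesis by (simp add: continuous_at_eps_delta)
qed

section \<open>Accumulation points under the Wolfe-Powell rules\<close>

lemma wolfe_powell_accumulation_critical:
  fixes f :: "'a::euclidean_space \<Rightarrow> real"
  assumes tb: "\<And>w. \<exists>T. tangent_below f w T"
    and "0 < \<mu>" "\<eta> < 1" and \<alpha>: "\<And>k. \<alpha> k > 0"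
    and wp: "\<And>k. wolfe_powell \<mu> \<eta> f (W k) (- gradient f (W k)) (\<alpha> k)"
    and step: "\<And>k. W (Suc k) = W k - \<alpha> k *\<^sub>R gradient f (W k)"
    and acc: "accumulation_point W a"
  shows "gradient f a = 0"
proof (rule ccontr)
  assume nz: "gradient f a \<noteq> 0"
  let ?g = "gradient f"
  note grad = tangent_below_gradient[OF someI_ex[OF tb]]
  have contf: "isCont f a"
    using grad(1)[of a] unfolding gderiv_def by (rule has_derivative_continuous)
  have contg: "isCont ?g a" by (rule convex_gradient_continuous[OF tb])
  \<comment> \<open>Along the negative gradient the initial slope is minus the squared gradient
    norm, which reverses the curvature inequality.\<close>
  have armijo: "f (W (Suc k)) \<le> f (W k) - \<mu> * \<alpha> k * (?g (W k) \<bullet> ?g (W k))"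
    and curv: "?g (W (Suc k)) \<bullet> ?g (W k) \<le> \<eta> * (?g (W k) \<bullet> ?g (W k))" for k
    using wp[of k] by (simp_all add: wolfe_powell_def step)
  have "f (W (Suc k)) \<le> f (W k)" for k
    using armijo[of k] \<open>0 < \<mu>\<close> \<alpha>[of k] by (smt (verit) inner_ge_zero mult_nonneg_nonneg)
  then have dec: "decseq (\<lambda>k. f (W k))" by (rule decseq_SucI)
  obtain r where r: "strict_mono r" and lim: "(\<lambda>k. W (r k)) \<longlonglongrightarrow> a"
    using acc by (auto simp: accumulation_point_def o_def)
  have limf: "(\<lambda>k. f (W (r k))) \<longlonglongrightarrow> f a"
    by (rule isCont_tendsto_compose[OF contf lim])
  have limg: "(\<lambda>k. ?g (W (r k))) \<longlonglongrightarrow> ?g a"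
    by (rule isCont_tendsto_compose[OF contg lim])
  \<comment> \<open>The subsequence may skip iterates, but the values never increase, so the
    decrease between consecutive members dominates that of the single step at \<open>r k\<close>. It
    tends to \<open>0\<close> because the values along the subsequence converge.\<close>
  have drop: "\<mu> * (\<alpha> (r k) * (?g (W (r k)) \<bullet> ?g (W (r k)))) \<le> f (W (r k)) - f (W (r (Suc k)))" for k
  proof -
    have "Suc (r k) \<le> r (Suc k)" using r by (simp add: strict_mono_Suc_iff Suc_leI)
    then have "f (W (r (Suc k))) \<le> f (W (Suc (r k)))" using decseqD[OF dec] by blast
    then show ?thesis using armijo[of "r k"] by (simp add: mult.assoc)
  qed
  have "(\<lambda>k. \<mu> * (\<alpha> (r k) * (?g (W (r k)) \<bullet> ?g (W (r k))))) \<longlonglongrightarrow> 0"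
  proof (rule tendsto_sandwich[of "\<lambda>_. 0" _ _ "\<lambda>k. f (W (r k)) - f (W (r (Suc k)))"])
    show "(\<lambda>k. f (W (r k)) - f (W (r (Suc k)))) \<longlonglongrightarrow> 0"
      using tendsto_diff[OF limf LIMSEQ_Suc[OF limf]] by simp
    show "\<forall>\<^sub>F k in sequentially. 0 \<le> \<mu> * (\<alpha> (r k) * (?g (W (r k)) \<bullet> ?g (W (r k))))"
      using \<open>0 < \<mu>\<close> \<alpha> by (auto simp: less_imp_le)
  qed (use drop in auto)
  moreover have "(\<lambda>k. \<mu> * (?g (W (r k)) \<bullet> ?g (W (r k)))) \<longlonglongrightarrow> \<mu> * (?g a \<bullet> ?g a)"
    by (intro tendsto_intros limg)
  moreover have "\<mu> * (?g a \<bullet> ?g a) \<noteq> 0" using nz \<open>0 < \<mu>\<close> by simp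
  \<comment> \<open>Dividing by a quantity with nonzero limit recovers the stepsize.\<close>
  ultimately have "(\<lambda>k. \<mu> * (\<alpha> (r k) * (?g (W (r k)) \<bullet> ?g (W (r k)))) / (\<mu> * (?g (W (r k)) \<bullet> ?g (W (r k)))))
      \<longlonglongrightarrow> 0 / (\<mu> * (?g a \<bullet> ?g a))"
    by (rule tendsto_divide)
  moreover have "\<forall>\<^sub>F k in sequentially. ?g (W (r k)) \<noteq> 0"
    using tendsto_imp_eventually_ne[OF limg nz] .
  then have "\<forall>\<^sub>F k in sequentially. \<mu> * (\<alpha> (r k) * (?g (W (r k)) \<bullet> ?g (W (r k)))) / (\<mu> * (?g (W (r k)) \<bullet> ?g (W (r k)))) = \<alpha> (r k)"
    by eventually_elim (use \<open>0 < \<mu>\<close> in simp)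
  ultimately have lim\<alpha>: "(\<lambda>k. \<alpha> (r k)) \<longlonglongrightarrow> 0"
    by (simp add: tendsto_cong)
  have "(\<lambda>k. W (Suc (r k))) \<longlonglongrightarrow> a - 0 *\<^sub>R ?g a"
    unfolding step by (intro tendsto_intros lim lim\<alpha> limg)
  then have "(\<lambda>k. ?g (W (Suc (r k)))) \<longlonglongrightarrow> ?g a"
    using isCont_tendsto_compose[OF contg] by simp
  then have "(\<lambda>k. ?g (W (Suc (r k))) \<bullet> ?g (W (r k))) \<longlonglongrightarrow> ?g a \<bullet> ?g a"
    by (intro tendsto_intros limg)
  moreover have "(\<lambda>k. \<eta> * (?g (W (r k)) \<bullet> ?g (W (r k)))) \<longlonglongrightarrow> \<eta> * (?g a \<bullet> ?g a)"
    by (intro tendsto_intros limg)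
  ultimately have "?g a \<bullet> ?g a \<le> \<eta> * (?g a \<bullet> ?g a)"
    using curv by (intro LIMSEQ_le) auto
  then have "(1 - \<eta>) * (?g a \<bullet> ?g a) \<le> 0" by (simp add: algebra_simps)
  moreover have "(1 - \<eta>) * (?g a \<bullet> ?g a) > 0" using nz \<open>\<eta> < 1\<close> by simp
  ultimately show False by simp
qed

subsection \<open>The regularised logistic objective\<close>

text \<open>The columns of \<open>X ** Y\<close> are combinations of those of \<open>X\<close>;
  conversely, padding \<open>p\<close> with zeros reproduces \<open>X *v p\<close>.\<close>

lemma range_hconcat_self_mult:
  fixes X :: "real^'m^'n" and Y :: "real^'c^'m"
  shows "range ((*v) (hconcat X (X ** Y))) = range ((*v) X)"
proof -
  have split: "hconcat A B *v z = A *v (\<chi> k. z $ Inl k) + B *v (\<chi> k. z $ Inr k)"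
    for A :: "real^'m^'n" and B :: "real^'c^'n" and z
    by (simp add: hconcat_def matrix_vector_mult_def vec_eq_iff UNIV_Plus_UNIV[symmetric] sum.Plus del: UNIV_Plus_UNIV)
  have "hconcat X (X ** Y) *v z = X *v ((\<chi> k. z $ Inl k) + Y *v (\<chi> k. z $ Inr k))" for z
    by (simp add: split matrix_vector_mul_assoc matrix_vector_right_distrib)
  moreover have "X *v p = hconcat X (X ** Y) *v (\<chi> k. case k of Inl a \<Rightarrow> p $ a | Inr b \<Rightarrow> 0)" for p
  proof -
    have "(\<chi> k. p $ k) = p" "(\<chi> k. 0) = (0 :: real^'c)" by (simp_all add: vec_eq_iff)
    then show ?thesis by (simp add: split)
  qed
  ultimately show ?thesis by (metis (no_types, lifting) rangeI subsetI image_subset_iff subset_antisym)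
qed

text \<open>\<open>h\<close> is affine with linear part \<open>L\<close>, and all its values share
  the range of \<open>data_matrix x\<close>. Both estimates of the expansion therefore hold for
  every displacement, and \<open>onorm L\<close> turns the bound in \<open>L (V - W)\<close> into
  one in \<open>V - W\<close>.\<close>

lemma nuclear_norm_features_tangent_below:
  fixes x :: "'n::finite \<Rightarrow> real^'m::finite" and W :: "real^'m^'c::finite"
  shows "\<exists>T. tangent_below (\<lambda>W :: real^'m^'c. nuclear_norm (hconcat (data_matrix x) (output_matrix x W))) W T"
proof -
  let ?X = "data_matrix x"
  define h where "h V = hconcat ?X (output_matrix x V)" for V :: "real^'m^'c"
  define L where "L V = hconcat (0 :: real^'m^'n) (output_matrix x V)" for V :: "real^'m^'c"
  have lin: "linear L"
    by (intro linearI) (auto simp: L_def hconcat_def output_matrix_def matrix_matrix_mult_def transpose_def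
        vec_eq_iff sum.distrib sum_distrib_left algebra_simps split: sum.split)
  have h: "h V = h W + L (V - W)" for V
    by (auto simp: h_def L_def hconcat_def output_matrix_def matrix_matrix_mult_def transpose_def
        vec_eq_iff sum_subtractf algebra_simps split: sum.split)
  have range: "range ((*v) (h V)) = range ((*v) ?X)" for V
    by (simp add: h_def output_matrix_def range_hconcat_self_mult)
  obtain T C where T: "linear T" and C: "C \<ge> 0"
    and lower: "\<And>D. nuclear_norm (h W) + T D \<le> nuclear_norm (h W + D)"
    and upper: "\<And>D. range ((*v) (h W + D)) \<subseteq> range ((*v) (h W)) \<Longrightarrow>
       nuclear_norm (h W + D) \<le> nuclear_norm (h W) + T D + C * (norm D)\<^sup>2"
    using nuclear_norm_expansion[of "h W"] by blast
  have "tangent_below (\<lambda>V. nuclear_norm (h V)) W (T \<circ> L)"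
  proof (rule tangent_below_squeeze)
    show "linear (T \<circ> L)" using lin T by (rule linear_compose)
    show "C * (onorm L)\<^sup>2 \<ge> 0" using C by simp
    show "nuclear_norm (h W) + (T \<circ> L) (V - W) \<le> nuclear_norm (h V)" for V
      using lower[of "L (V - W)"] by (simp add: h[symmetric])
    show "nuclear_norm (h V) \<le> nuclear_norm (h W) + (T \<circ> L) (V - W) + C * (onorm L)\<^sup>2 * (norm (V - W))\<^sup>2" for V
    proof -
      have "nuclear_norm (h V) \<le> nuclear_norm (h W) + T (L (V - W)) + C * (norm (L (V - W)))\<^sup>2"
        using upper[of "L (V - W)"] by (simp add: h[symmetric] range)
      also have "(norm (L (V - W)))\<^sup>2 \<le> (onorm L * norm (V - W))\<^sup>2"
        using lin by (intro power_mono onorm) (auto simp: linear_conv_bounded_linear)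
      finally show ?thesis
        using C by (simp add: power_mult_distrib mult.assoc mult_left_mono)
    qed
  qed
  then show ?thesis unfolding h_def by blast
qed

section \<open>Log-sum-exp, the logistic loss and the objective\<close>

text \<open>The derivative is the softmax-weighted mean of the entries of the direction; the tangent
  inequality comes from \<open>1 + s \<le> exp s\<close>.\<close>

lemma log_sum_exp_tangent_below:
  fixes z :: "real^'c::finite"
  shows "\<exists>T. tangent_below (\<lambda>z :: real^'c. ln (\<Sum>j\<in>UNIV. exp (z $ j))) z T"
proof -
  let ?S = "\<lambda>z :: real^'c. \<Sum>j\<in>UNIV. exp (z $ j)"
  let ?T = "\<lambda>h :: real^'c. (\<Sum>j\<in>UNIV. exp (z $ j) * h $ j) / ?S z"
  have S: "?S v > 0" for v by (intro sum_pos) auto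
  have "(?S has_derivative (\<lambda>h. \<Sum>j\<in>UNIV. exp (z $ j) * h $ j)) (at z)"
    by (auto intro!: derivative_eq_intros bounded_linear_imp_has_derivative bounded_linear_vec_nth
        simp: mult.commute)
  from has_derivative_ln[OF S this]
  have "((\<lambda>z. ln (?S z)) has_derivative ?T) (at z)"
    by (simp add: divide_inverse mult.commute)
  moreover have "ln (?S z) + ?T (v - z) \<le> ln (?S v)" for v
  proof -
    \<comment> \<open>\<open>t\<close> is the softmax mean of the entries of \<open>v - z\<close>,
      so the deviations from it have weighted sum zero and can be added without changing
      \<open>?S z\<close>.\<close>
    define t where "t = ?T (v - z)"
    have t: "(\<Sum>j\<in>UNIV. exp (z $ j) * (v $ j - z $ j)) = ?S z * t"
      using S[of z] by (simp add: t_def)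
    have "?S z = (\<Sum>j\<in>UNIV. exp (z $ j) * (1 + (v $ j - z $ j - t)))"
      using t by (simp add: distrib_left right_diff_distrib sum.distrib sum_subtractf sum_distrib_right)
    also have "\<dots> \<le> (\<Sum>j\<in>UNIV. exp (z $ j) * exp (v $ j - z $ j - t))"
      by (intro sum_mono mult_left_mono exp_ge_add_one_self) auto
    also have "\<dots> = exp (- t) * ?S v"
      by (simp add: sum_distrib_left mult_exp_exp)
    finally have "ln (?S z) \<le> ln (exp (- t) * ?S v)"
      using S by (simp add: ln_le_cancel_iff)
    also have "\<dots> = - t + ln (?S v)" using S[of v] by (simp add: ln_mult)
    finally show ?thesis by (simp add: t_def)
  qed
  ultimately show ?thesis unfolding tangent_below_def by blast
qed

text \<open>Each sample contributes the log-sum-exp of the scores \<open>W *v x i\<close> minus a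
  linear function of them, and the scores are linear in \<open>W\<close>.\<close>

lemma logistic_loss_tangent_below:
  fixes x :: "'n::finite \<Rightarrow> real^'m::finite" and y :: "'n \<Rightarrow> real^'c::finite"
  shows "\<exists>T. tangent_below (logistic_loss x y) W T"
proof -
  let ?lse = "\<lambda>z :: real^'c. ln (\<Sum>j\<in>UNIV. exp (z $ j))"
  let ?f = "\<lambda>i (W :: real^'m^'c). ?lse (W *v x i) + - (y i \<bullet> (W *v x i))"
  have "\<exists>T. tangent_below (?f i) W T" for i
  proof -
    have lin: "linear (\<lambda>W :: real^'m^'c. W *v x i)"
      by (intro linearI) (simp_all add: matrix_vector_mult_add_rdistrib scaleR_matrix_vector_assoc[symmetric])
    obtain T where "tangent_below ?lse (W *v x i) T" using log_sum_exp_tangent_below by blast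
    note lse = tangent_below_compose_linear[OF this lin]
    have "linear (\<lambda>W :: real^'m^'c. - (y i \<bullet> (W *v x i)))"
      by (intro linearI) (simp_all add: linear_add[OF lin] linear_scale[OF lin] inner_add_right)
    from tangent_below_add[OF lse tangent_below_linear[OF this]] show ?thesis by blast
  qed
  then have "\<forall>i. \<exists>T. tangent_below (?f i) W T" by (rule allI)
  from choice[OF this] obtain T where T: "\<forall>i. tangent_below (?f i) W (T i)" by (rule exE)
  have "tangent_below (\<lambda>W. (1 / real CARD('n)) * (\<Sum>i\<in>UNIV. ?f i W)) W (\<lambda>h. (1 / real CARD('n)) * (\<Sum>i\<in>UNIV. T i h))"
    by (intro tangent_below_scale tangent_below_sum T[rule_format]) simp
  moreover have "logistic_loss x y = (\<lambda>W. (1 / real CARD('n)) * (\<Sum>i\<in>UNIV. ?f i W))"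
  proof
    fix V
    have "(\<Sum>j\<in>UNIV. y i $ j * ((V $ j) \<bullet> x i)) - ln (\<Sum>j\<in>UNIV. exp ((V $ j) \<bullet> x i)) = - ?f i V" for i
      by (simp add: inner_vec_def[of "y i"] matrix_vector_mul_component)
    then show "logistic_loss x y V = (1 / real CARD('n)) * (\<Sum>i\<in>UNIV. ?f i V)"
      unfolding logistic_loss_def by (simp only: sum_negf)
  qed
  ultimately show ?thesis by auto
qed

lemma objective_tangent_below:
  assumes "lam \<ge> 0"
  shows "\<exists>T. tangent_below (objective x y lam) W T"
proof -
  obtain T U where "tangent_below (logistic_loss x y) W T"
    "tangent_below (\<lambda>W. nuclear_norm (hconcat (data_matrix x) (output_matrix x W))) W U"
    using logistic_loss_tangent_below nuclear_norm_features_tangent_below by blast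
  from tangent_below_add[OF this(1) tangent_below_scale[OF this(2) assms]]
  show ?thesis by (auto simp: objective_def[abs_def])
qed

theorem theorem3p3:
  fixes x :: "'n::finite \<Rightarrow> real^'m::finite"
    and y :: "'n \<Rightarrow> real^'c::finite"
    and lam \<mu> \<eta> :: real
    and W :: "nat \<Rightarrow> real^'m^'c"
    and \<alpha> :: "nat \<Rightarrow> real"
    and Wstar :: "real^'m^'c"
  assumes "\<And>i. one_hot (y i)"
    and "lam > 0"
    and "\<And>k s. singular_value (output_matrix x (W k)) s \<Longrightarrow> s \<noteq> 0"
    and "0 < \<mu>" "\<mu> < 1" "0 < \<eta>" "\<eta> < 1"
    and "\<And>k. \<alpha> k > 0"
    and "\<And>k. wolfe_powell \<mu> \<eta> (objective x y lam) (W k) (- gradient (objective x y lam) (W k)) (\<alpha> k)"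
    and "\<And>k. W (Suc k) = W k - \<alpha> k *\<^sub>R gradient (objective x y lam) (W k)"
    and "accumulation_point W Wstar"
  shows "global_minimizer (objective x y lam) Wstar"
proof -
  have tb: "\<exists>T. tangent_below (objective x y lam) V T" for V
    using \<open>lam > 0\<close> by (simp add: objective_tangent_below)
  have "gradient (objective x y lam) Wstar = 0"
    using wolfe_powell_accumulation_critical[OF tb] assms(4,7-11) by blast
  \<comment> \<open>With zero gradient, the affine minorant at \<open>Wstar\<close> is
    constant.\<close>
  then show ?thesis
    using tangent_below_gradient(2)[OF someI_ex[OF tb], of Wstar] by (simp add: global_minimizer_def)
qed

end
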